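(* Let $G$ be a finite simple connected graph with $n$ vertices and $m\ge 1$ edges. Then $$2m\leq SDD(G)\leq m\left(n-1+\frac{1}{n-1}\right).$$ Equality holds on the left if and only if $G$ is regular, and equality holds on the right if and only if $G\cong S_n$.
   Context: For a finite simple graph $G$ with edge set $E_G$, $d_u$ denotes the degree of vertex $u$, and the symmetric division deg index is $SDD(G)=\sum_{uv\in E_G}\left(\frac{d_u}{d_v}+\frac{d_v}{d_u}\right)$. $S_n$ denotes the star graph with $n$ vertices (so $S_2\cong K_2$). *)

theory Defs
  imports Complex_Main "Graph_Theory.Graph_Theory"
begin

text \<open>
  A finite simple graph is a \<^locale>\<open>pair_graph\<close>: a finite vertex set together with a symmetric,
  irreflexive set of arcs. An undirected edge \<open>uv\<close> is thus represented by the two arcs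
  \<open>(u, v)\<close> and \<open>(v, u)\<close>, and the degree of a vertex is its out-degree.
\<close>

definition edges :: "'a pair_pre_digraph \<Rightarrow> 'a set set" where
  "edges G = {{u, v} | u v. (u, v) \<in> parcs G}"

definition degree :: "'a pair_pre_digraph \<Rightarrow> 'a \<Rightarrow> nat" where
  "degree G u = out_degree (with_proj G) u"

definition regular :: "'a pair_pre_digraph \<Rightarrow> bool" where
  "regular G \<longleftrightarrow> (\<exists>r. \<forall>u \<in> pverts G. degree G u = r)"

text \<open>
  The summand belonging to an undirected edge. It is symmetric in the two endpoints, so the
  description is unique; see \<open>sdd_term_doubleton\<close>.
\<close>

definition sdd_term :: "'a pair_pre_digraph \<Rightarrow> 'a set \<Rightarrow> real" where
  "sdd_term G e = (THE x. \<exists>u v. e = {u, v} \<and>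
     x = real (degree G u) / real (degree G v) + real (degree G v) / real (degree G u))"

definition SDD :: "'a pair_pre_digraph \<Rightarrow> real" where
  "SDD G = (\<Sum>e \<in> edges G. sdd_term G e)"

lemma sdd_term_doubleton:
  "sdd_term G {u, v} =
     real (degree G u) / real (degree G v) + real (degree G v) / real (degree G u)"
  unfolding sdd_term_def by (rule the_equality) (auto simp: doubleton_eq_iff)

text \<open>The star with vertices \<open>0, \<dots>, n - 1\<close> and centre \<open>0\<close>.\<close>

definition star_graph :: "nat \<Rightarrow> nat pair_pre_digraph" where
  "star_graph n = \<lparr> pverts = {..<n},
     parcs = {(u, v). u < n \<and> v < n \<and> u \<noteq> v \<and> (u = 0 \<or> v = 0)} \<rparr>"

lemma pair_graph_star_graph: "pair_graph (star_graph n)"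
proof -
  have "finite (parcs (star_graph n))"
    by (rule finite_subset[of _ "{..<n} \<times> {..<n}"]) (auto simp: star_graph_def)
  then show ?thesis
    by unfold_locales (auto simp: star_graph_def symmetric_def sym_def)
qed

end

theory Submission
  imports Defs
begin

text \<open>
  Both bounds hold edge by edge: the degrees \<open>a\<close>, \<open>b\<close> of adjacent vertices lie between \<open>1\<close> and
  \<open>n - 1\<close>, and \<open>x + 1 / x\<close> is increasing for \<open>x \<ge> 1\<close>, so that
  \<open>2 \<le> a / b + b / a \<le> (n - 1) + 1 / (n - 1)\<close>.
  On the left, equality means that adjacent vertices have equal degrees, which spreads along
  walks. On the right, it means that every edge joins a leaf to a vertex \<open>c\<close> of degree \<open>n - 1\<close>;
  an edge avoiding \<open>c\<close> would have both ends adjacent to \<open>c\<close>, hence no leaf among them.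
\<close>

section \<open>Real inequalities for \<open>a / b + b / a\<close>\<close>

text \<open>The excess over 2 is the square of \<open>a - b\<close> divided by the positive number
  \<open>a * b\<close>.\<close>

lemma two_le_ratio_sum:
  fixes a b :: real
  assumes "a > 0" "b > 0"
  shows "2 \<le> a / b + b / a" and "a / b + b / a = 2 \<longleftrightarrow> a = b"
proof -
  have eq: "a / b + b / a - 2 = (a - b)\<^sup>2 / (a * b)"
    using assms by (simp add: field_simps power2_eq_square)
  moreover have "(a - b)\<^sup>2 / (a * b) \<ge> 0"
    using assms by simp
  ultimately show "2 \<le> a / b + b / a" by linarith
  have "a / b + b / a = 2 \<longleftrightarrow> (a - b)\<^sup>2 / (a * b) = 0"
    using eq by linarith
  then show "a / b + b / a = 2 \<longleftrightarrow> a = b"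
    using assms by auto
qed

text \<open>The gap factors as \<open>(k * a - b) * (k * b - a) / (k * a * b)\<close>. Both factors
  are nonnegative, since \<open>b \<le> k \<le> k * a\<close> and
  \<open>a \<le> b \<le> k * b\<close>; equality means that one of them vanishes.\<close>

lemma ratio_sum_le_aux:
  fixes a b k :: real
  assumes "1 \<le> a" "a \<le> b" "b \<le> k"
  shows "a / b + b / a \<le> k + 1 / k"
    and "a / b + b / a = k + 1 / k \<longleftrightarrow> a = 1 \<and> b = k"
proof -
  have pos: "a > 0" "b > 0" "k > 0" using assms by auto
  have eq: "k + 1 / k - (a / b + b / a) = (k * a - b) * (k * b - a) / (k * a * b)"
    using pos by (simp add: field_simps)
  have ka: "k \<le> k * a" and kb: "b \<le> k * b"
    using assms pos by simp_all
  then have num: "b \<le> k * a" "a \<le> k * b"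
    using assms by linarith+
  have nonneg: "(k * a - b) * (k * b - a) / (k * a * b) \<ge> 0"
    using num pos by simp
  show "a / b + b / a \<le> k + 1 / k"
    using eq nonneg by linarith
  show "a / b + b / a = k + 1 / k \<longleftrightarrow> a = 1 \<and> b = k"
  proof
    assume "a / b + b / a = k + 1 / k"
    then have "k * a = b \<or> k * b = a"
      using eq pos by auto
    then show "a = 1 \<and> b = k"
    proof
      assume "k * a = b"
      \<comment> \<open>The chain \<open>b \<le> k \<le> k * a = b\<close> collapses.\<close>
      then have "k * a = k" using ka assms by linarith
      then show ?thesis using \<open>k * a = b\<close> pos by simp
    next
      assume "k * b = a"
      \<comment> \<open>Here \<open>b \<le> k * b = a \<le> b\<close>, so \<open>k = 1\<close> and
        all three numbers are 1.\<close>
      then have "k * b = b" using kb assms by linarith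
      then have "k = 1" using pos by simp
      then show ?thesis using assms by simp
    qed
  qed (use pos in simp)
qed

lemma ratio_sum_le:
  fixes a b k :: real
  assumes "1 \<le> a" "1 \<le> b" "a \<le> k" "b \<le> k"
  shows "a / b + b / a \<le> k + 1 / k"
    and "a / b + b / a = k + 1 / k \<longleftrightarrow> a = 1 \<and> b = k \<or> a = k \<and> b = 1"
proof -
  have "a / b + b / a \<le> k + 1 / k \<and>
      (a / b + b / a = k + 1 / k \<longleftrightarrow> a = 1 \<and> b = k \<or> a = k \<and> b = 1)"
  proof (cases "a \<le> b")
    case True
    then show ?thesis using ratio_sum_le_aux[of a b k] assms by auto
  next
    case False
    then show ?thesis using ratio_sum_le_aux[of b a k] assms by (auto simp: add.commute)
  qed
  then show "a / b + b / a \<le> k + 1 / k"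
    and "a / b + b / a = k + 1 / k \<longleftrightarrow> a = 1 \<and> b = k \<or> a = k \<and> b = 1"
    by auto
qed

section \<open>Sums, edges and stars\<close>

text \<open>A single strict inequality would make the sums differ. This reduces both equality cases
  to single edges.\<close>

lemma sum_eq_iff_if_le:
  fixes f g :: "'a \<Rightarrow> real"
  assumes "finite A" "\<And>x. x \<in> A \<Longrightarrow> f x \<le> g x"
  shows "sum f A = sum g A \<longleftrightarrow> (\<forall>x \<in> A. f x = g x)"
  using sum_mono_inv[of f A g] assms by (auto intro: sum.cong)

lemma edges_conv_image: "edges G = (\<lambda>(u, v). {u, v}) ` parcs G"
  by (auto simp: edges_def)

text \<open>Stars with arbitrary vertex set and centre, so that being a star can be expressed inside
  \<open>G\<close> without an isomorphism.\<close>

definition star_arcs :: "'a set \<Rightarrow> 'a \<Rightarrow> ('a \<times> 'a) set" where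
  "star_arcs V c = {(u, v). u \<in> V \<and> v \<in> V \<and> u \<noteq> v \<and> (u = c \<or> v = c)}"

section \<open>Neighbourhoods and degrees\<close>

context pair_graph
begin

lemma finite_edges: "finite (edges G)"
  by (simp add: edges_conv_image pair_finite_arcs)

lemma parcs_sym: "(u, v) \<in> parcs G \<Longrightarrow> (v, u) \<in> parcs G"
  using pair_sym_arcs by (auto simp: symmetric_def elim: symE)

lemma degree_conv_card_neighbours: "degree G u = card {v. (u, v) \<in> parcs G}"
proof -
  have "out_arcs (with_proj G) u = Pair u ` {v. (u, v) \<in> parcs G}"
    by (auto simp: out_arcs_def)
  then show ?thesis
    by (simp add: degree_def out_degree_def card_image inj_on_def)
qed

lemma neighbours_subset: "{v. (u, v) \<in> parcs G} \<subseteq> pverts G - {u}"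
  using wellformed' no_loops' by blast

lemma finite_neighbours: "finite {v. (u, v) \<in> parcs G}"
  using neighbours_subset pair_finite_verts by (rule finite_subset[OF _ finite_Diff])

lemma degree_ge_1:
  assumes "(u, v) \<in> parcs G"
  shows "1 \<le> degree G u"
proof -
  have "{v. (u, v) \<in> parcs G} \<noteq> {}" using assms by auto
  then show ?thesis
    using finite_neighbours by (simp add: degree_conv_card_neighbours Suc_le_eq card_gt_0_iff)
qed

lemma degree_le:
  assumes "u \<in> pverts G"
  shows "degree G u \<le> card (pverts G) - 1"
  using card_mono[OF _ neighbours_subset, of u] assms pair_finite_verts
  by (simp add: degree_conv_card_neighbours)

text \<open>The neighbours lie in the finite set \<open>pverts G - {u}\<close>, which has the same
  cardinality.\<close>

lemma neighbours_eq_if_degree_max: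
  assumes "u \<in> pverts G" "degree G u = card (pverts G) - 1"
  shows "{v. (u, v) \<in> parcs G} = pverts G - {u}"
  using assms neighbours_subset pair_finite_verts
  by (intro card_subset_eq) (auto simp: degree_conv_card_neighbours)

lemma neighbour_unique_if_degree_1:
  assumes "degree G u = 1" "(u, v) \<in> parcs G" "(u, w) \<in> parcs G"
  shows "v = w"
proof -
  obtain x where "{v. (u, v) \<in> parcs G} = {x}"
    using assms(1) by (auto simp: degree_conv_card_neighbours card_1_singleton_iff)
  then show ?thesis using assms(2,3) by (metis mem_Collect_eq singletonD)
qed

section \<open>Bounds for one edge and for the whole index\<close>

lemma sdd_term_bounds:
  assumes "(u, v) \<in> parcs G"
  defines "k \<equiv> real (card (pverts G)) - 1"
  shows "2 \<le> sdd_term G {u, v}"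
    and "sdd_term G {u, v} = 2 \<longleftrightarrow> degree G u = degree G v"
    and "sdd_term G {u, v} \<le> k + 1 / k"
    and "sdd_term G {u, v} = k + 1 / k \<longleftrightarrow>
      degree G u = 1 \<and> degree G v = card (pverts G) - 1 \<or>
      degree G u = card (pverts G) - 1 \<and> degree G v = 1"
proof -
  have uv: "u \<in> pverts G" "v \<in> pverts G" using assms(1) wellformed' by auto
  then have "card (pverts G) \<ge> 1"
    using pair_finite_verts by (auto simp: Suc_le_eq card_gt_0_iff)
  \<comment> \<open>With at least one vertex, truncated subtraction on naturals agrees with the real
    \<open>k\<close>.\<close>
  then have k: "k = real (card (pverts G) - 1)"
    unfolding k_def by (simp add: of_nat_diff)
  have d: "1 \<le> degree G u" "1 \<le> degree G v"
    using degree_ge_1 assms(1) parcs_sym by blast+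
  then have ge: "1 \<le> real (degree G u)" "1 \<le> real (degree G v)" by auto
  have le: "real (degree G u) \<le> k" "real (degree G v) \<le> k"
    unfolding k using degree_le uv by simp_all
  show "2 \<le> sdd_term G {u, v}" "sdd_term G {u, v} = 2 \<longleftrightarrow> degree G u = degree G v"
    using two_le_ratio_sum[of "real (degree G u)" "real (degree G v)"] ge
    by (simp_all add: sdd_term_doubleton)
  show "sdd_term G {u, v} \<le> k + 1 / k"
    unfolding sdd_term_doubleton using ratio_sum_le(1)[OF ge le] .
  show "sdd_term G {u, v} = k + 1 / k \<longleftrightarrow>
      degree G u = 1 \<and> degree G v = card (pverts G) - 1 \<or>
      degree G u = card (pverts G) - 1 \<and> degree G v = 1"
    unfolding sdd_term_doubleton ratio_sum_le(2)[OF ge le] unfolding k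
    by (simp only: of_nat_eq_iff of_nat_eq_1_iff)
qed

lemma SDD_lower:
  shows "2 * real (card (edges G)) \<le> SDD G"
    and "SDD G = 2 * real (card (edges G)) \<longleftrightarrow> (\<forall>(u, v) \<in> parcs G. degree G u = degree G v)"
proof -
  have ge: "2 \<le> sdd_term G e" if "e \<in> edges G" for e
    using that sdd_term_bounds(1) by (auto simp: edges_def)
  \<comment> \<open>Written as a constant sum, the bound can be compared with \<open>SDD G\<close>
    term by term.\<close>
  have const: "(\<Sum>e\<in>edges G. 2) = 2 * real (card (edges G))" by simp
  show "2 * real (card (edges G)) \<le> SDD G"
    unfolding SDD_def const[symmetric] using ge by (rule sum_mono)
  have "SDD G = 2 * real (card (edges G)) \<longleftrightarrow> (\<forall>e \<in> edges G. sdd_term G e = 2)"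
    unfolding SDD_def const[symmetric]
    \<comment> \<open>The equations are flipped because \<open>sum_eq_iff_if_le\<close> has the
      smaller side on the left.\<close>
    by (subst (1 2) eq_commute) (rule sum_eq_iff_if_le[OF finite_edges ge])
  then show "SDD G = 2 * real (card (edges G)) \<longleftrightarrow>
      (\<forall>(u, v) \<in> parcs G. degree G u = degree G v)"
    using sdd_term_bounds(2) by (auto simp: edges_conv_image)
qed

lemma SDD_upper:
  defines "k \<equiv> real (card (pverts G)) - 1"
  shows "SDD G \<le> real (card (edges G)) * (k + 1 / k)"
    and "SDD G = real (card (edges G)) * (k + 1 / k) \<longleftrightarrow>
      (\<forall>(u, v) \<in> parcs G. degree G u = 1 \<and> degree G v = card (pverts G) - 1 \<or>
        degree G u = card (pverts G) - 1 \<and> degree G v = 1)"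
proof -
  have le: "sdd_term G e \<le> k + 1 / k" if "e \<in> edges G" for e
    using that sdd_term_bounds(3) by (auto simp: edges_def k_def)
  have const: "(\<Sum>e\<in>edges G. k + 1 / k) = real (card (edges G)) * (k + 1 / k)" by simp
  show "SDD G \<le> real (card (edges G)) * (k + 1 / k)"
    unfolding SDD_def const[symmetric] using le by (rule sum_mono)
  have "SDD G = real (card (edges G)) * (k + 1 / k) \<longleftrightarrow>
      (\<forall>e \<in> edges G. sdd_term G e = k + 1 / k)"
    unfolding SDD_def const[symmetric]
    using le by (rule sum_eq_iff_if_le[OF finite_edges])
  \<comment> \<open>Each edge is now visited through both of its arcs, with the same condition on
    \<open>{u, v}\<close>.\<close>
  also have "\<dots> \<longleftrightarrow> (\<forall>(u, v) \<in> parcs G. sdd_term G {u, v} = k + 1 / k)"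
    by (auto simp: edges_conv_image)
  also have "\<dots> \<longleftrightarrow>
      (\<forall>(u, v) \<in> parcs G. degree G u = 1 \<and> degree G v = card (pverts G) - 1 \<or>
        degree G u = card (pverts G) - 1 \<and> degree G v = 1)"
    using sdd_term_bounds(4) by (intro ball_cong) (auto simp: k_def)
  finally show "SDD G = real (card (edges G)) * (k + 1 / k) \<longleftrightarrow>
      (\<forall>(u, v) \<in> parcs G. degree G u = 1 \<and> degree G v = card (pverts G) - 1 \<or>
        degree G u = card (pverts G) - 1 \<and> degree G v = 1)" .
qed

section \<open>The equality cases in terms of degrees\<close>

lemma regular_iff_adjacent_degrees_eq:
  assumes "Digraph_Component.connected (with_proj G)"
  shows "regular G \<longleftrightarrow> (\<forall>(u, v) \<in> parcs G. degree G u = degree G v)"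
proof
  assume "regular G"
  then show "\<forall>(u, v) \<in> parcs G. degree G u = degree G v"
    using wellformed' by (fastforce simp: regular_def)
next
  assume arcs: "\<forall>(u, v) \<in> parcs G. degree G u = degree G v"
  have walk: "degree G u = degree G v" if "u \<rightarrow>\<^sup>*\<^bsub>with_proj G\<^esub> v" for u v
    using that by (induction rule: reachable_induct) (use arcs in auto)
  have "degree G u = degree G v" if "u \<in> pverts G" "v \<in> pverts G" for u v
  proof (rule walk)
    \<comment> \<open>Connectedness speaks of the symmetric closure; as the arcs of \<open>G\<close>
      are already symmetric, reachability is the same in \<open>G\<close>.\<close>
    have "u \<rightarrow>\<^sup>*\<^bsub>with_proj (mk_symmetric (with_proj G))\<^esub> v"
      using assms that by (auto simp: Digraph_Component.connected_def strongly_connected_def)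
    then show "u \<rightarrow>\<^sup>*\<^bsub>with_proj G\<^esub> v"
      using reachable_mk_symmetric_eq[OF pair_sym_arcs] by simp
  qed
  then show "regular G"
    unfolding regular_def by metis
qed

lemma star_iff_degrees:
  assumes "parcs G \<noteq> {}"
  shows "(\<exists>c \<in> pverts G. parcs G = star_arcs (pverts G) c) \<longleftrightarrow>
    (\<forall>(u, v) \<in> parcs G. degree G u = 1 \<and> degree G v = card (pverts G) - 1 \<or>
      degree G u = card (pverts G) - 1 \<and> degree G v = 1)"
    (is "_ \<longleftrightarrow> ?deg")
proof
  assume "\<exists>c \<in> pverts G. parcs G = star_arcs (pverts G) c"
  then obtain c where c: "c \<in> pverts G" and arcs: "parcs G = star_arcs (pverts G) c" by blast
  have "{v. (c, v) \<in> parcs G} = pverts G - {c}"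
    using c by (auto simp: arcs star_arcs_def)
  then have centre: "degree G c = card (pverts G) - 1"
    using c pair_finite_verts by (simp add: degree_conv_card_neighbours)
  have leaf: "degree G u = 1" if "u \<in> pverts G" "u \<noteq> c" for u
  proof -
    have "{v. (u, v) \<in> parcs G} = {c}" using that c by (auto simp: arcs star_arcs_def)
    then show ?thesis by (simp add: degree_conv_card_neighbours)
  qed
  show ?deg
    using centre leaf by (auto simp: arcs star_arcs_def)
next
  assume deg: ?deg
  obtain x y where xy: "(x, y) \<in> parcs G" using assms by fastforce
  \<comment> \<open>The centre is an end of maximal degree of any one arc.\<close>
  obtain c where c: "c \<in> pverts G" "degree G c = card (pverts G) - 1"
    using deg xy wellformed' by blast
  have nbrs: "(c, v) \<in> parcs G" if "v \<in> pverts G" "v \<noteq> c" for v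
    using neighbours_eq_if_degree_max[OF c] that by blast
  \<comment> \<open>Otherwise the end of degree 1 would have two distinct neighbours:
    \<open>c\<close> and the other end.\<close>
  have "u = c \<or> v = c" if "(u, v) \<in> parcs G" for u v
  proof (rule ccontr)
    assume "\<not> (u = c \<or> v = c)"
    then have "(u, c) \<in> parcs G" "(v, c) \<in> parcs G"
      using nbrs parcs_sym wellformed' that by blast+
    moreover have "(v, u) \<in> parcs G" using that by (rule parcs_sym)
    moreover have "degree G u = 1 \<or> degree G v = 1" using deg that by auto
    ultimately show False
      using neighbour_unique_if_degree_1 that \<open>\<not> (u = c \<or> v = c)\<close> by metis
  qed
  then have "parcs G \<subseteq> star_arcs (pverts G) c"
    using wellformed' no_loops' by (fastforce simp: star_arcs_def)
  moreover have "star_arcs (pverts G) c \<subseteq> parcs G"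
    using nbrs parcs_sym[OF nbrs] by (auto simp: star_arcs_def)
  ultimately show "\<exists>c \<in> pverts G. parcs G = star_arcs (pverts G) c" using c(1) by blast
qed

section \<open>Isomorphism with the star graph\<close>

text \<open>An isomorphism singles out the vertex sent to 0 as centre; conversely, any bijection
  onto \<open>{..<n}\<close>, with \<open>n\<close> the number of vertices, that sends
  \<open>c\<close> to 0 matches the two stars.\<close>

lemma iso_star_graph_iff:
  assumes "pverts G \<noteq> {}"
  shows "digraph_iso (with_proj G) (with_proj (star_graph (card (pverts G)))) \<longleftrightarrow>
    (\<exists>c \<in> pverts G. parcs G = star_arcs (pverts G) c)"
proof
  let ?n = "card (pverts G)"
  have n: "0 < ?n" using assms pair_finite_verts by (simp add: card_gt_0_iff)
  have star: "parcs (star_graph ?n) = star_arcs {..<?n} 0"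
    by (auto simp: star_graph_def star_arcs_def)
  {
    assume "digraph_iso (with_proj G) (with_proj (star_graph ?n))"
    then obtain f where f: "digraph_isomorphism f"
      and H: "with_proj (star_graph ?n) = app_iso f (with_proj G)"
      by (auto simp: digraph_iso_def)
    define h where "h = iso_verts f"
    have inj: "inj_on h (pverts G)"
      using f by (simp add: digraph_isomorphism_def h_def)
    have V: "h ` pverts G = {..<?n}"
      using arg_cong[OF H, of verts] by (simp add: star_graph_def h_def)
    have A: "iso_arcs f ` parcs G = star_arcs {..<?n} 0"
      using arg_cong[OF H, of arcs] by (simp add: star)
    \<comment> \<open>The image digraph again has the projections as tail and head, which forces
      \<open>iso_arcs f\<close> to act as \<open>h\<close> on both ends of an arc.\<close>
    have "iso_tail f = fst" "iso_head f = snd"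
      using arg_cong[OF H, of tail] arg_cong[OF H, of head] by simp_all
    then have arc: "iso_arcs f (u, v) = (h u, h v)" if "(u, v) \<in> parcs G" for u v
      using f that by (auto simp: digraph_isomorphism_def h_def prod_eq_iff)
    have "0 \<in> h ` pverts G" using V n by simp
    then obtain c where c: "c \<in> pverts G" "h c = 0" by auto
    have "(u, v) \<in> parcs G \<longleftrightarrow> (u, v) \<in> star_arcs (pverts G) c" for u v
    proof
      assume uv: "(u, v) \<in> parcs G"
      then have "(h u, h v) \<in> star_arcs {..<?n} 0"
        using A arc by (metis image_eqI)
      then have "h u = h c \<or> h v = h c" using c by (auto simp: star_arcs_def)
      then show "(u, v) \<in> star_arcs (pverts G) c"
        using inj_on_eq_iff[OF inj _ c(1)] wellformed'[OF uv] no_loops'[OF uv]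
        by (auto simp: star_arcs_def)
    next
      assume uv: "(u, v) \<in> star_arcs (pverts G) c"
      then have uv': "u \<in> pverts G" "v \<in> pverts G" by (auto simp: star_arcs_def)
      have "(h u, h v) \<in> star_arcs {..<?n} 0"
        using uv c inj V by (auto simp: star_arcs_def inj_on_eq_iff)
      \<comment> \<open>The star arc comes from some arc of \<open>G\<close>, which injectivity of
        \<open>h\<close> identifies with \<open>(u, v)\<close>.\<close>
      then obtain x y where xy: "(x, y) \<in> parcs G" "(h u, h v) = iso_arcs f (x, y)"
        unfolding A[symmetric] by auto
      then have "h u = h x" "h v = h y" using arc by auto
      then show "(u, v) \<in> parcs G"
        using inj xy(1) uv' wellformed' by (metis inj_onD)
    qed
    then show "\<exists>c \<in> pverts G. parcs G = star_arcs (pverts G) c"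
      using c(1) by auto
  next
    assume "\<exists>c \<in> pverts G. parcs G = star_arcs (pverts G) c"
    then obtain c where c: "c \<in> pverts G" and arcs: "parcs G = star_arcs (pverts G) c" by blast
    \<comment> \<open>The vertex map numbers the other vertices from 1 in any order and sends
      \<open>c\<close> to 0.\<close>
    have "card (pverts G - {c}) = card {1..<?n}"
      using c pair_finite_verts by simp
    then obtain g where "bij_betw g (pverts G - {c}) {1..<?n}"
      using pair_finite_verts finite_same_card_bij by (metis finite_Diff finite_atLeastLessThan)
    then have g: "inj_on g (pverts G - {c})" "g ` (pverts G - {c}) = {1..<?n}"
      by (auto simp: bij_betw_def)
    define h where "h = g(c := 0)"
    have hc: "h c = 0" by (simp add: h_def)
    have h_rest: "h ` (pverts G - {c}) = {1..<?n}"
      using g(2) by (auto simp: h_def)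
    have "pverts G = insert c (pverts G - {c})" using c by auto
    then have "h ` pverts G = insert 0 {1..<?n}" using hc h_rest by (metis image_insert)
    then have V: "h ` pverts G = {..<?n}" using n by auto
    \<comment> \<open>A map on a finite set whose image has the same size is injective.\<close>
    have "card (h ` pverts G) = card (pverts G)" using V by simp
    then have inj: "inj_on h (pverts G)"
      using pair_finite_verts by (rule eq_card_imp_inj_on[rotated])
    have zero: "h u = 0 \<longleftrightarrow> u = c" if "u \<in> pverts G" for u
      using inj_on_eq_iff[OF inj that c] hc by simp
    \<comment> \<open>Injectivity keeps the ends of an arc distinct; surjectivity supplies
      preimages, and \<open>zero\<close> recognises the centre among them.\<close>
    have A: "map_prod h h ` parcs G = star_arcs {..<?n} 0"
    proof (intro equalityI subrelI)
      fix i j assume "(i, j) \<in> map_prod h h ` parcs G"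
      then obtain u v where uv: "i = h u" "j = h v" "(u, v) \<in> star_arcs (pverts G) c"
        by (auto simp: arcs)
      then have "h u \<noteq> h v" using inj_on_eq_iff[OF inj, of u v] by (auto simp: star_arcs_def)
      then show "(i, j) \<in> star_arcs {..<?n} 0"
        using uv V hc by (auto simp: star_arcs_def)
    next
      fix i j assume ij: "(i, j) \<in> star_arcs {..<?n} 0"
      then have "i \<in> h ` pverts G" "j \<in> h ` pverts G" by (auto simp: V star_arcs_def)
      then obtain u v where uv: "u \<in> pverts G" "v \<in> pverts G" "i = h u" "j = h v" by auto
      then have "(u, v) \<in> parcs G" using ij zero by (auto simp: arcs star_arcs_def)
      then show "(i, j) \<in> map_prod h h ` parcs G" using uv by force
    qed
    have inj_arcs: "inj_on (map_prod h h) (parcs G)"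
      using map_prod_inj_on[OF inj inj] by (rule inj_on_subset) (auto dest: wellformed')
    let ?f = "\<lparr>iso_verts = h, iso_arcs = map_prod h h, iso_head = snd, iso_tail = fst\<rparr>"
    have "digraph_isomorphism ?f"
      using inj inj_arcs wf_digraph_axioms by (simp add: digraph_isomorphism_def)
    moreover have "with_proj (star_graph ?n) = app_iso ?f (with_proj G)"
      by (rule pre_digraph.equality) (simp_all add: V A star, simp add: star_graph_def)
    ultimately show "digraph_iso (with_proj G) (with_proj (star_graph ?n))"
      unfolding digraph_iso_def by blast
  }
qed

end

theorem theorem3p1:
  fixes G :: "'a pair_pre_digraph" and n m :: nat
  assumes "pair_graph G"
    and "Digraph_Component.connected (with_proj G)"
    and "n = card (pverts G)"
    and "m = card (edges G)"
    and "m \<ge> 1"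
  shows "2 * real m \<le> SDD G
    \<and> SDD G \<le> real m * (real n - 1 + 1 / (real n - 1))
    \<and> (SDD G = 2 * real m \<longleftrightarrow> regular G)
    \<and> (SDD G = real m * (real n - 1 + 1 / (real n - 1))
         \<longleftrightarrow> digraph_iso (with_proj G) (with_proj (star_graph n)))"
proof -
  interpret pair_graph G by fact
  \<comment> \<open>From \<open>m \<ge> 1\<close> come an arc and a vertex, as the star criteria
    require.\<close>
  have "edges G \<noteq> {}" using assms(4,5) by auto
  then have arcs: "parcs G \<noteq> {}" by (auto simp: edges_conv_image)
  then have verts: "pverts G \<noteq> {}" using wellformed' by fastforce
  show ?thesis
    \<comment> \<open>In each equivalence both sides become the same condition on the degrees of
      adjacent vertices.\<close>
    unfolding assms(3,4) SDD_lower(2) SDD_upper(2) regular_iff_adjacent_degrees_eq[OF assms(2)]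
      iso_star_graph_iff[OF verts] star_iff_degrees[OF arcs]
    using SDD_lower(1) SDD_upper(1) by blast
qed

end
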